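(* Let $J$, $\overline{J}$, $\underline{J}$ be as in the context, let $\eta\in(0,1)$, and let $(\theta^{(t)})_{t\ge -1}$, $(\overline{\mathbf u}^{(t)})_{t\ge 0}$, $(\underline{\mathbf u}^{(t)})_{t\ge 1}$ be sequences with $\theta^{(-1)}=\theta^{(0)}\in\mathbb{R}^d$ and $\overline{\mathbf u}^{(0)}\in\mathcal U$ arbitrary, such that for every $t\ge 1$ $$\overline{J}(\theta^{(t-1)},\overline{\mathbf u}^{(t)})\le \eta\,\underline{J}(\theta^{(t-1)},\underline{\mathbf u}^{(t)})+(1-\eta)\,\overline{J}(\theta^{(t-2)},\overline{\mathbf u}^{(t-1)})$$ and $$\theta^{(t)}\in\arg\min_{\theta\in\mathbb{R}^d}\overline{J}(\theta,\overline{\mathbf u}^{(t)}).$$ For $t\ge 1$ put $$c_t:=\overline{J}(\theta^{(t-2)},\overline{\mathbf u}^{(t-1)})-\underline{J}(\theta^{(t-1)},\underline{\mathbf u}^{(t)}).$$ Then $\lim_{t\to\infty}c_t=0$.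
   Context: $J:\mathbb{R}^d\to\mathbb{R}_{\ge 0}$ is a differentiable function. $\mathcal U\subseteq\mathbb{R}^{\bar D}$, and $\overline{J}(\theta,\overline{\mathbf u})$ is a real-valued differentiable function of $\theta\in\mathbb{R}^d$ and $\overline{\mathbf u}\in\mathcal U$ such that: (1) $\overline{J}(\theta,\overline{\mathbf u})\ge J(\theta)$ for all $\theta\in\mathbb{R}^d$, $\overline{\mathbf u}\in\mathcal U$; (2) $\overline{J}(\theta,\overline{\mathbf u})$ is convex in $\overline{\mathbf u}$ and satisfies strong duality; (3) $J(\theta)=\min_{\overline{\mathbf u}\in\mathcal U}\overline{J}(\theta,\overline{\mathbf u})$ for all $\theta$. The dual objective is a real-valued function $\underline{J}(\theta,\underline{\mathbf u})$ with a dual parameter $\underline{\mathbf u}$ ranging over some set, with $\underline{J}(\theta,\underline{\mathbf u})\le J(\theta)$ for all $\theta,\underline{\mathbf u}$. Strong duality means that $\sup_{\underline{\mathbf u}}\underline{J}(\theta,\underline{\mathbf u})=J(\theta)$ for every $\theta$. *)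

theory Defs
  imports "HOL-Analysis.Analysis"
begin

text \<open>
  The supremum is taken in the extended reals, so that it is the genuine least upper bound
  without side conditions on nonemptiness or boundedness.
\<close>

definition strong_duality :: "'w set \<Rightarrow> ('p \<Rightarrow> 'w \<Rightarrow> real) \<Rightarrow> ('p \<Rightarrow> real) \<Rightarrow> bool" where
  "strong_duality W Jlow J \<longleftrightarrow> (\<forall>\<theta>. (SUP w\<in>W. ereal (Jlow \<theta> w)) = ereal (J \<theta>))"

end

(* The upper values a t = Jbar (theta (t-1)) (u t) satisfy
   eta * c (t+1) <= a t - a (t+1), while weak duality and the minimality of theta t give
   c (t+1) >= 0.  So a decreases, is bounded below by 0, and its differences tend to 0. *)

theory Submission
  imports Defs
begin

theorem proposition1:
  fixes J :: "real ^ 'd \<Rightarrow> real"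
    and U :: "(real ^ 'D) set"
    and Jbar :: "real ^ 'd \<Rightarrow> real ^ 'D \<Rightarrow> real"
    and W :: "'w set"
    and Jlow :: "real ^ 'd \<Rightarrow> 'w \<Rightarrow> real"
    and \<eta> :: real
    and \<theta> :: "int \<Rightarrow> real ^ 'd"
    and ubar :: "nat \<Rightarrow> real ^ 'D"
    and ulow :: "nat \<Rightarrow> 'w"
    and c :: "nat \<Rightarrow> real"
  assumes J_nonneg: "\<And>x. 0 \<le> J x"
    and J_differentiable: "J differentiable_on UNIV"
    and Jbar_differentiable: "(\<lambda>(x, u). Jbar x u) differentiable_on (UNIV \<times> U)"
    and Jbar_upper: "\<And>x u. u \<in> U \<Longrightarrow> J x \<le> Jbar x u"
    and Jbar_convex: "\<And>x. convex_on U (Jbar x)"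
    and Jbar_min: "\<And>x. \<exists>u. is_arg_min (Jbar x) (\<lambda>u. u \<in> U) u \<and> J x = Jbar x u"
    and Jlow_lower: "\<And>x w. w \<in> W \<Longrightarrow> Jlow x w \<le> J x"
    and duality: "strong_duality W Jlow J"
    and eta: "0 < \<eta>" "\<eta> < 1"
    and init: "\<theta> (-1) = \<theta> 0"
    and ubar_in: "\<And>t. ubar t \<in> U"
    and ulow_in: "\<And>t. t \<ge> 1 \<Longrightarrow> ulow t \<in> W"
    and gap_step: "\<And>t. t \<ge> 1 \<Longrightarrow>
      Jbar (\<theta> (int t - 1)) (ubar t)
        \<le> \<eta> * Jlow (\<theta> (int t - 1)) (ulow t) + (1 - \<eta>) * Jbar (\<theta> (int t - 2)) (ubar (t - 1))"
    and theta_step: "\<And>t. t \<ge> 1 \<Longrightarrow>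
      is_arg_min (\<lambda>x. Jbar x (ubar t)) (\<lambda>_. True) (\<theta> (int t))"
    and c_eq: "\<And>t. t \<ge> 1 \<Longrightarrow>
      c t = Jbar (\<theta> (int t - 2)) (ubar (t - 1)) - Jlow (\<theta> (int t - 1)) (ulow t)"
  shows "c \<longlonglongrightarrow> 0"
proof -
  define a where "a = (\<lambda>t. Jbar (\<theta> (int t - 1)) (ubar t))"
  \<comment> \<open>The dual value is shifted by one index, so that \<open>a t\<close> and
    \<open>b t\<close> are the two values weighted in \<open>gap_step\<close> for
    \<open>Suc t\<close>. The facts below then hold for every natural \<open>t\<close>, including
    0.\<close>
  define b where "b = (\<lambda>t. Jlow (\<theta> (int t)) (ulow (Suc t)))"
  have c_Suc: "c (Suc t) = a t - b t" for t
    using c_eq[of "Suc t"] by (simp add: a_def b_def)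
  have a_Suc: "a (Suc t) \<le> \<eta> * b t + (1 - \<eta>) * a t" for t
    using gap_step[of "Suc t"] by (simp add: a_def b_def)
  have b_le_a: "b t \<le> a t" for t
  proof -
    have "b t \<le> J (\<theta> (int t))"
      unfolding b_def by (intro Jlow_lower ulow_in) simp
    also have "\<dots> \<le> Jbar (\<theta> (int t)) (ubar t)"
      by (intro Jbar_upper ubar_in)
    \<comment> \<open>For positive \<open>t\<close>, \<open>\<theta> (int t)\<close> minimises
      \<open>Jbar\<close> against \<open>ubar t\<close> and so does at least as well as its
      predecessor. At index 0 there is no minimality to use; there \<open>init\<close> makes both
      sides equal.\<close>
    also have "\<dots> \<le> a t"
    proof (cases "t = 0")
      case True
      then show ?thesis using init by (simp add: a_def)
    next
      case False
      then show ?thesis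
        using theta_step[of t] by (simp add: a_def is_arg_min_linorder)
    qed
    finally show ?thesis .
  qed
  have c_upper: "c (Suc t) \<le> (a t - a (Suc t)) / \<eta>" for t
    using a_Suc[of t] eta by (simp add: c_Suc field_simps)
  have a_nonneg: "0 \<le> a t" for t
    unfolding a_def using J_nonneg Jbar_upper[OF ubar_in] by (rule order_trans)
  have "decseq a"
  proof (rule decseq_SucI)
    fix t
    \<comment> \<open>The bound in \<open>a_Suc\<close> is a convex combination of
      \<open>b t\<close> and \<open>a t\<close>; replacing \<open>b t\<close> by the larger
      \<open>a t\<close> collapses it to \<open>a t\<close>.\<close>
    have "\<eta> * b t \<le> \<eta> * a t"
      using b_le_a eta by (intro mult_left_mono) auto
    then show "a (Suc t) \<le> a t"
      using a_Suc[of t] unfolding left_diff_distrib by linarith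
  qed
  then obtain L where L: "a \<longlonglongrightarrow> L"
    using decseq_convergent[of a 0] a_nonneg by blast
  \<comment> \<open>The sequence \<open>a\<close> and its shift have the same limit
    \<open>L\<close>, and \<open>\<eta>\<close> is a fixed nonzero divisor.\<close>
  have "(\<lambda>t. (a t - a (Suc t)) / \<eta>) \<longlonglongrightarrow> (L - L) / \<eta>"
    using eta by (intro tendsto_intros L LIMSEQ_Suc[OF L]) simp
  then have upper: "(\<lambda>t. (a t - a (Suc t)) / \<eta>) \<longlonglongrightarrow> 0"
    by simp
  \<comment> \<open>Squeeze: \<open>b_le_a\<close> gives the lower bound 0, \<open>c_upper\<close>
    the vanishing upper bound. The shift leaves out \<open>c 0\<close>, about which
    \<open>c_eq\<close> says nothing and which does not affect the limit.\<close>
  have "(\<lambda>t. c (Suc t)) \<longlonglongrightarrow> 0"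
    using b_le_a c_upper
    by (intro tendsto_sandwich[OF _ _ tendsto_const upper] always_eventually) (auto simp: c_Suc)
  then show ?thesis
    by (rule LIMSEQ_imp_Suc)
qed

end
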